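(* Let $\mu^-(\alpha)$ be the lowest eigenvalue of $T$ in $W_3\subset H^1_{\#}(\alpha,Y)$. Suppose there is a $\theta>0$ such that for all $u\in W_3$ (for every $\alpha\in Y^\star$) $$\|\nabla u\|^2_{L^2(Y\setminus D)}\ge\theta\,\|\nabla u\|^2_{L^2(D)}.$$ Let $\rho=\min\{\frac12,\frac\theta2\}$. Then $\mu^-(\alpha)+\frac12>\rho$ for all $\alpha\in Y^\star$.
   Context: Let the dimension be $d\in\{2,3\}$, $Y=(0,1]^d$, $Y^\star=(-\pi,\pi]^d$. $D\Subset Y$ is a union of finitely many disjoint simply connected sets (inclusions) $D_i$, $i=1,\dots,N$, with $C^2$ boundary, surrounded by $Y\setminus D$. $H^1_{\#}(\alpha,Y)$ is the Hilbert space of functions $h\in H^1_{loc}(\mathbb{R}^d)$ with $h(x+p)=h(x)e^{i\alpha\cdot p}$ for all $p\in\mathbb{Z}^d$ (with in addition zero average over $Y$ when $\alpha=0$), with inner product $\langle u,v\rangle=\int_Y\nabla u\cdot\nabla\bar v\,dx$. For $\alpha\ne0$, $W_1$ is the completion in $H^1_{\#}(\alpha,Y)$ of the subspace of functions with support away from $D$, and $W_2$ is the space of functions in $H^1_0(D)$ extended by zero into $Y$. For $\alpha=0$, $W_1$ is the completion in $H^1_{\#}(0,Y)$ of the subspace of functions with support away from $D$, and $W_2=\{\tilde u-(\int_D\tilde u\,dx)1_Y\}$ with $\tilde u\in H^1_0(D)$ extended by zero and $1_Y$ the indicator function of $Y$. $W_3=(W_1\oplus W_2)^\perp$. $T:W_3\to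 W_3$ is the compact self-adjoint operator with $\langle Tu,v\rangle=\frac12\int_{Y\setminus D}\nabla u\cdot\nabla\bar v\,dx-\frac12\int_D\nabla u\cdot\nabla\bar v\,dx$ for $u,v\in W_3$; with $\{\mu_i\}$ its eigenvalues, $\mu^-(\alpha)=\min_i\mu_i$.
   Formalization: The case θ = 1 with μ⁻(α) = 0 is excluded: there ρ = 1/2 = μ⁻(α) + 1/2, so the strict inequality fails; for θ = 1 the lowest eigenvalue, if it exists, is always 0 since T is compact and nonnegative. *)

theory Defs
  imports "HOL-Analysis.Analysis"
begin

section \<open>Geometry\<close>

definition unit_cell :: "(real ^ 'n::finite) set" where
  "unit_cell = {x. \<forall>i. 0 < x $ i \<and> x $ i \<le> 1}"

definition brillouin_zone :: "(real ^ 'n::finite) set" where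
  "brillouin_zone = {a. \<forall>i. - pi < a $ i \<and> a $ i \<le> pi}"

text \<open>\<open>Ck_on k U f\<close>: all partial derivatives of order at most \<open>k\<close> exist and are continuous on
  the set \<open>U\<close>, which is meant to be open; \<open>g i\<close> is the \<open>i\<close>-th partial derivative of \<open>f\<close>.\<close>

primrec Ck_on :: "nat \<Rightarrow> (real ^ 'n::finite) set \<Rightarrow> (real ^ 'n \<Rightarrow> real) \<Rightarrow> bool" where
  "Ck_on 0 U f \<longleftrightarrow> continuous_on U f"
| "Ck_on (Suc k) U f \<longleftrightarrow>
     (\<exists>g :: 'n \<Rightarrow> real ^ 'n \<Rightarrow> real.
        (\<forall>x\<in>U. (f has_derivative (\<lambda>h. \<Sum>i\<in>UNIV. g i x * h $ i)) (at x)) \<and>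
        (\<forall>i. Ck_on k U (g i)))"

text \<open>Near each boundary point, an open set with \<open>C\<^sup>2\<close> boundary is the negativity set of a
  \<open>C\<^sup>2\<close> function with nonvanishing derivative; it therefore lies on one side of its boundary.\<close>

definition C2_boundary :: "(real ^ 'n::finite) set \<Rightarrow> bool" where
  "C2_boundary S \<longleftrightarrow>
     (\<forall>p\<in>frontier S. \<exists>U \<phi>. open U \<and> p \<in> U \<and> Ck_on 2 U \<phi> \<and>
        (\<forall>x\<in>U. frechet_derivative \<phi> (at x) \<noteq> (\<lambda>h. 0)) \<and>
        S \<inter> U = {x \<in> U. \<phi> x < 0})"

text \<open>\<open>D\<close> is compactly contained in the open cell, so that it is surrounded by
  \<open>unit_cell - D\<close>.\<close>

definition inclusions :: "(real ^ 'n::finite) set \<Rightarrow> bool" where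
  "inclusions D \<longleftrightarrow>
     (\<exists>F. finite F \<and> F \<noteq> {} \<and> disjoint F \<and> D = \<Union>F \<and>
        (\<forall>S\<in>F. open S \<and> S \<noteq> {} \<and> simply_connected S \<and> C2_boundary S)) \<and>
     closure D \<subseteq> interior unit_cell"

section \<open>Sobolev spaces\<close>

text \<open>Elements of function spaces are represented by functions on the whole space; two
  representatives that agree almost everywhere denote the same element.\<close>

definition test_function :: "(real ^ 'n::finite) set \<Rightarrow> (real ^ 'n \<Rightarrow> real) \<Rightarrow> bool" where
  "test_function U \<phi> \<longleftrightarrow>
     (\<forall>k. Ck_on k UNIV \<phi>) \<and> compact (closure {x. \<phi> x \<noteq> 0}) \<and> closure {x. \<phi> x \<noteq> 0} \<subseteq> U"

definition complex_test_function :: "(real ^ 'n::finite) set \<Rightarrow> (real ^ 'n \<Rightarrow> complex) \<Rightarrow> bool" where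
  "complex_test_function U \<phi> \<longleftrightarrow>
     test_function U (\<lambda>x. Re (\<phi> x)) \<and> test_function U (\<lambda>x. Im (\<phi> x))"

definition L2_loc :: "(real ^ 'n::finite \<Rightarrow> 'b::euclidean_space) \<Rightarrow> bool" where
  "L2_loc f \<longleftrightarrow> f \<in> borel_measurable lebesgue \<and>
     (\<forall>K. compact K \<longrightarrow> set_integrable lebesgue K (\<lambda>x. (norm (f x))\<^sup>2))"

definition weak_gradient :: "(real ^ 'n::finite \<Rightarrow> complex) \<Rightarrow> (real ^ 'n \<Rightarrow> complex ^ 'n) \<Rightarrow> bool" where
  "weak_gradient u g \<longleftrightarrow>
     (\<forall>\<phi>. test_function UNIV \<phi> \<longrightarrow>
        (\<forall>i. (LINT x|lebesgue. frechet_derivative \<phi> (at x) (axis i 1) *\<^sub>R u x) =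
             - (LINT x|lebesgue. \<phi> x *\<^sub>R (g x $ i))))"

definition H1_loc :: "(real ^ 'n::finite \<Rightarrow> complex) set" where
  "H1_loc = {u. L2_loc u \<and> (\<exists>g. L2_loc g \<and> weak_gradient u g)}"

text \<open>A representative of the weak gradient, which is unique almost everywhere.\<close>

definition grad :: "(real ^ 'n::finite \<Rightarrow> complex) \<Rightarrow> real ^ 'n \<Rightarrow> complex ^ 'n" where
  "grad u = (SOME g. L2_loc g \<and> weak_gradient u g)"

definition dirichlet_form ::
    "(real ^ 'n::finite) set \<Rightarrow> (real ^ 'n \<Rightarrow> complex) \<Rightarrow> (real ^ 'n \<Rightarrow> complex) \<Rightarrow> complex" where
  "dirichlet_form S u v =
     (LINT x:S|lebesgue. (\<Sum>i\<in>UNIV. grad u x $ i * cnj (grad v x $ i)))"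

text \<open>The squared \<open>L\<^sup>2(S)\<close> norm of the gradient.\<close>

definition grad_norm_sq :: "(real ^ 'n::finite) set \<Rightarrow> (real ^ 'n \<Rightarrow> complex) \<Rightarrow> real" where
  "grad_norm_sq S u = (LINT x:S|lebesgue. (norm (grad u x))\<^sup>2)"

definition H1_per :: "real ^ 'n::finite \<Rightarrow> (real ^ 'n \<Rightarrow> complex) set" where
  "H1_per \<alpha> = {h \<in> H1_loc.
     (\<forall>p. (\<forall>i. p $ i \<in> \<int>) \<longrightarrow> (AE x in lebesgue. h (x + p) = h x * cis (\<alpha> \<bullet> p))) \<and>
     (\<alpha> = 0 \<longrightarrow> (LINT x:unit_cell|lebesgue. h x) = 0)}"

abbreviation H_inner :: "(real ^ 'n::finite \<Rightarrow> complex) \<Rightarrow> (real ^ 'n \<Rightarrow> complex) \<Rightarrow> complex" where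
  "H_inner u v \<equiv> dirichlet_form unit_cell u v"

abbreviation H_norm :: "(real ^ 'n::finite \<Rightarrow> complex) \<Rightarrow> real" where
  "H_norm u \<equiv> sqrt (grad_norm_sq unit_cell u)"

text \<open>\<open>H\<^sup>1\<^sub>0(D)\<close>, each element extended by zero outside \<open>D\<close>: the closure of the test functions
  supported in \<open>D\<close> with respect to the full \<open>H\<^sup>1(D)\<close> norm.\<close>

definition H1_0 :: "(real ^ 'n::finite) set \<Rightarrow> (real ^ 'n \<Rightarrow> complex) set" where
  "H1_0 D = {w \<in> H1_loc. (AE x in lebesgue. x \<notin> D \<longrightarrow> w x = 0) \<and>
     (\<forall>\<epsilon>>0. \<exists>\<phi>. complex_test_function D \<phi> \<and>
        (LINT x:D|lebesgue. (norm (w x - \<phi> x))\<^sup>2) + grad_norm_sq D (\<lambda>x. w x - \<phi> x) < \<epsilon>)}"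

section \<open>The decomposition and the operator\<close>

definition supported_away :: "(real ^ 'n::finite) set \<Rightarrow> real ^ 'n \<Rightarrow> (real ^ 'n \<Rightarrow> complex) set" where
  "supported_away D \<alpha> = {v \<in> H1_per \<alpha>.
     \<exists>U. open U \<and> closure D \<subseteq> U \<and> (AE x in lebesgue. x \<in> U \<longrightarrow> v x = 0)}"

definition W1 :: "(real ^ 'n::finite) set \<Rightarrow> real ^ 'n \<Rightarrow> (real ^ 'n \<Rightarrow> complex) set" where
  "W1 D \<alpha> = {u \<in> H1_per \<alpha>. \<forall>\<epsilon>>0. \<exists>v\<in>supported_away D \<alpha>. H_norm (\<lambda>x. u x - v x) < \<epsilon>}"

text \<open>Membership in \<open>H1_per \<alpha>\<close> extends a function given on the unit cell quasi-periodically
  to the whole space.\<close>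

definition W2 :: "(real ^ 'n::finite) set \<Rightarrow> real ^ 'n \<Rightarrow> (real ^ 'n \<Rightarrow> complex) set" where
  "W2 D \<alpha> = {u \<in> H1_per \<alpha>. \<exists>w\<in>H1_0 D.
     AE x in lebesgue. x \<in> unit_cell \<longrightarrow>
       u x = (if \<alpha> = 0 then w x - (LINT y:D|lebesgue. w y) else w x)}"

definition W3 :: "(real ^ 'n::finite) set \<Rightarrow> real ^ 'n \<Rightarrow> (real ^ 'n \<Rightarrow> complex) set" where
  "W3 D \<alpha> = {u \<in> H1_per \<alpha>.
     \<forall>w1\<in>W1 D \<alpha>. \<forall>w2\<in>W2 D \<alpha>. H_inner u (\<lambda>x. w1 x + w2 x) = 0}"

text \<open>The identity determines \<open>T\<close> up to equality almost everywhere of its values.\<close>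

definition is_T ::
    "(real ^ 'n::finite) set \<Rightarrow> real ^ 'n \<Rightarrow>
     ((real ^ 'n \<Rightarrow> complex) \<Rightarrow> (real ^ 'n \<Rightarrow> complex)) \<Rightarrow> bool" where
  "is_T D \<alpha> T \<longleftrightarrow>
     (\<forall>u\<in>W3 D \<alpha>. T u \<in> W3 D \<alpha> \<and>
        (\<forall>v\<in>W3 D \<alpha>. H_inner (T u) v =
           1/2 * dirichlet_form (unit_cell - D) u v - 1/2 * dirichlet_form D u v))"

text \<open>\<open>T\<close> is self-adjoint, so only real eigenvalues have to be considered.\<close>

definition T_eigenvalue ::
    "(real ^ 'n::finite) set \<Rightarrow> real ^ 'n \<Rightarrow>
     ((real ^ 'n \<Rightarrow> complex) \<Rightarrow> (real ^ 'n \<Rightarrow> complex)) \<Rightarrow> real \<Rightarrow> bool" where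
  "T_eigenvalue D \<alpha> T m \<longleftrightarrow>
     (\<exists>u\<in>W3 D \<alpha>. \<not> (AE x in lebesgue. u x = 0) \<and>
        (AE x in lebesgue. T u x = of_real m * u x))"

definition lowest_eigenvalue ::
    "(real ^ 'n::finite) set \<Rightarrow> real ^ 'n \<Rightarrow>
     ((real ^ 'n \<Rightarrow> complex) \<Rightarrow> (real ^ 'n \<Rightarrow> complex)) \<Rightarrow> real \<Rightarrow> bool" where
  "lowest_eigenvalue D \<alpha> T m \<longleftrightarrow>
     T_eigenvalue D \<alpha> T m \<and> (\<forall>m'. T_eigenvalue D \<alpha> T m' \<longrightarrow> m \<le> m')"

end

theory Submission
  imports Defs
begin

text \<open>Let \<open>u\<close> be an eigenfunction of \<open>T\<close> with eigenvalue \<open>\<mu>\<close>, and let \<open>A\<close> and \<open>B\<close> be its gradient energies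
  in \<open>unit_cell - D\<close> and in \<open>D\<close>. Testing the identity that characterises \<open>T u\<close> with \<open>u\<close> itself
  gives \<open>\<mu> (A + B) = (A - B) / 2\<close>, that is, \<open>\<mu> + 1/2 = A / (A + B)\<close>. Since \<open>A \<ge> \<theta> B\<close>, this quotient
  is at least \<open>\<theta> / (1 + \<theta>)\<close>, which exceeds \<open>\<rho>\<close> unless \<open>\<theta> = 1\<close>; for \<open>\<theta> = 1\<close> both are \<open>1/2\<close>, and
  equality of the quotient with \<open>1/2\<close> means \<open>A = B\<close>, hence \<open>\<mu> = 0\<close>.

  Two facts about weak gradients make this computation legitimate. The gradient of \<open>T u\<close> must be
  \<open>\<mu>\<close> times the gradient of \<open>u\<close> (\<open>grad_scale\<close>), although the two are chosen independently; this is
  uniqueness of the weak gradient. And \<open>A + B\<close> must be nonzero, that is, the energy must separate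
  points of \<open>H1_per \<alpha>\<close> (\<open>H1_per_zero_if_grad_norm_zero\<close>): if the gradient vanishes in the cell, then
  by uniqueness it inherits the quasi-periodicity of \<open>u\<close> and vanishes everywhere, so \<open>u\<close> is a
  constant, and the phase factor (for \<open>\<alpha> \<noteq> 0\<close>) or the zero average (for \<open>\<alpha> = 0\<close>) makes it zero.

  Both facts rest on the fundamental lemma of the calculus of variations
  (\<open>AE_zero_if_orthogonal_to_bumps\<close>), for which a supply of smooth functions of compact support
  is constructed. Constancy of a function \<open>v\<close> with zero weak gradient
  (\<open>AE_constant_if_weak_gradient_zero\<close>) follows because the integral of \<open>v\<close> against a moving bump
  does not change, so that \<open>v\<close> is invariant under all translations almost everywhere.\<close>

section \<open>Smooth functions of compact support\<close>

text \<open>For \<open>p = 1\<close> this is the standard smooth function that vanishes on the negative half-line. The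
  polynomial factor makes the family closed under differentiation.\<close>

definition flat :: "real poly \<Rightarrow> real \<Rightarrow> real" where
  "flat p t = (if t > 0 then poly p (1/t) * exp (- (1/t)) else 0)"

lemma poly_times_exp_neg_tendsto_0: "((\<lambda>y. poly p y * exp (- y)) \<longlongrightarrow> (0::real)) at_top"
proof -
  have "((\<lambda>y. \<Sum>i\<le>degree p. coeff p i * (y ^ i / exp y)) \<longlongrightarrow> (\<Sum>i\<le>degree p. coeff p i * 0)) at_top"
    by (intro tendsto_sum tendsto_mult tendsto_const tendsto_power_div_exp_0)
  then show ?thesis
    by (simp add: poly_altdef exp_minus divide_inverse sum_distrib_right mult.assoc)
qed

text \<open>The differentiated polynomial is \<open>y\<^sup>2 (p - p')\<close> in \<open>y = 1/t\<close>, by the chain rule. At the origin the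
  difference quotient is again of the form \<open>q(y) exp (- y)\<close> with \<open>y\<close> tending to infinity.\<close>

lemma flat_has_derivative:
  "(flat p has_real_derivative flat ([:0, 0, 1:] * (p - pderiv p)) t) (at t)"
proof -
  consider "t > 0" | "t < 0" | "t = 0" by linarith
  then show ?thesis
  proof cases
    case 1
    have "((\<lambda>t. poly p (1/t) * exp (- (1/t))) has_real_derivative
        flat ([:0, 0, 1:] * (p - pderiv p)) t) (at t)"
      using 1 unfolding flat_def
      by (auto intro!: derivative_eq_intros DERIV_chain2[OF poly_DERIV] simp: field_simps power2_eq_square)
    then show ?thesis
      by (rule DERIV_cong_ev[OF refl _ refl, THEN iffD1, rotated])
        (use eventually_nhds_in_open[of "{0<..}" t] 1 in \<open>auto simp: flat_def elim: eventually_mono\<close>)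
  next
    case 2
    have "((\<lambda>t. 0) has_real_derivative flat ([:0, 0, 1:] * (p - pderiv p)) t) (at t)"
      using 2 by (simp add: flat_def)
    then show ?thesis
      by (rule DERIV_cong_ev[OF refl _ refl, THEN iffD1, rotated])
        (use eventually_nhds_in_open[of "{..<0}" t] 2 in \<open>auto simp: flat_def elim: eventually_mono\<close>)
  next
    case 3
    have "((\<lambda>h. poly (pCons 0 p) (1/h) * exp (- (1/h))) \<longlongrightarrow> 0) (at_right (0::real))"
      using filterlim_compose[OF poly_times_exp_neg_tendsto_0[of "pCons 0 p"] filterlim_inverse_at_top_right]
      by (simp add: field_simps)
    then have "((\<lambda>h. flat p h / h) \<longlongrightarrow> 0) (at_right 0)"
      by (rule Lim_transform_eventually)
        (auto simp: flat_def eventually_at_filter field_simps)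
    moreover have "((\<lambda>h. flat p h / h) \<longlongrightarrow> 0) (at_left 0)"
      by (rule Lim_transform_eventually[OF tendsto_const])
        (auto simp: flat_def eventually_at_filter)
    ultimately have "((\<lambda>h. flat p h / h) \<longlongrightarrow> 0) (at 0)"
      by (simp add: filterlim_split_at)
    then show ?thesis using 3 by (simp add: DERIV_def flat_def)
  qed
qed

text \<open>An algebra that contains cutoffs for all boxes and is closed under partial derivatives. Each
  member is then differentiable infinitely often, with no need to control higher derivatives
  explicitly.\<close>

inductive_set smooth_algebra :: "(real ^ 'n::finite \<Rightarrow> real) set" where
  base: "(\<lambda>x. flat p (c * (x $ i - a))) \<in> smooth_algebra"
| one: "(\<lambda>x. 1) \<in> smooth_algebra"
| add: "f \<in> smooth_algebra \<Longrightarrow> g \<in> smooth_algebra \<Longrightarrow> (\<lambda>x. f x + g x) \<in> smooth_algebra"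
| mult: "f \<in> smooth_algebra \<Longrightarrow> g \<in> smooth_algebra \<Longrightarrow> (\<lambda>x. f x * g x) \<in> smooth_algebra"

lemma flat_0 [simp]: "flat 0 t = 0" by (simp add: flat_def)

lemma smooth_algebra_zero: "(\<lambda>x. 0) \<in> smooth_algebra"
  using smooth_algebra.base[of 0] by simp

lemma smooth_algebra_prod:
  "finite I \<Longrightarrow> (\<And>i. i \<in> I \<Longrightarrow> f i \<in> smooth_algebra) \<Longrightarrow> (\<lambda>x. \<Prod>i\<in>I. f i x) \<in> smooth_algebra"
  by (induction I rule: finite_induct) (auto intro: smooth_algebra.intros)

lemma smooth_algebra_derivative:
  assumes "f \<in> smooth_algebra"
  shows "\<exists>g. (\<forall>i. g i \<in> smooth_algebra) \<and>
    (\<forall>x. (f has_derivative (\<lambda>h. \<Sum>i\<in>UNIV. g i x * h $ i)) (at x))"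
  using assms
proof (induction)
  case (base p c j a)
  let ?q = "smult c ([:0, 0, 1:] * (p - pderiv p))"
  define g where "g = (\<lambda>i. if i = j then (\<lambda>x::(real,'a) vec. flat ?q (c * (x $ j - a))) else (\<lambda>x. 0))"
  have "((\<lambda>x. flat p (c * (x $ j - a))) has_derivative (\<lambda>h. \<Sum>i\<in>UNIV. g i x * h $ i)) (at x)" for x
  proof -
    have "((\<lambda>x. flat p (c * (x $ j - a))) has_derivative
        (\<lambda>h. flat ([:0, 0, 1:] * (p - pderiv p)) (c * (x $ j - a)) * (c * h $ j))) (at x)"
      by (rule has_derivative_compose[where g = "flat p", OF _ flat_has_derivative[unfolded has_field_derivative_def]])
        (auto intro!: derivative_eq_intros bounded_linear_imp_has_derivative bounded_linear_vec_nth)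
    also have "(\<lambda>h. flat ([:0, 0, 1:] * (p - pderiv p)) (c * (x $ j - a)) * (c * h $ j)) = (\<lambda>h. \<Sum>i\<in>UNIV. g i x * h $ i)"
    proof
      fix h :: "(real,'a) vec"
      have "(\<Sum>i\<in>UNIV. g i x * h $ i) = (\<Sum>i\<in>UNIV. if i = j then flat ?q (c * (x $ j - a)) * h $ j else 0)"
        by (intro sum.cong) (auto simp: g_def)
      then show "flat ([:0, 0, 1:] * (p - pderiv p)) (c * (x $ j - a)) * (c * h $ j) = (\<Sum>i\<in>UNIV. g i x * h $ i)"
        by (simp add: flat_def)
    qed
    finally show ?thesis .
  qed
  moreover have "g i \<in> smooth_algebra" for i
    by (auto simp: g_def smooth_algebra_zero intro: smooth_algebra.base)
  ultimately show ?case by blast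
next
  case one
  show ?case by (rule exI[of _ "\<lambda>i x. 0"]) (auto simp: smooth_algebra_zero)
next
  case (add f1 f2)
  then obtain g1 g2 where g: "\<forall>i. g1 i \<in> smooth_algebra" "\<forall>i. g2 i \<in> smooth_algebra"
    "\<forall>x. (f1 has_derivative (\<lambda>h. \<Sum>i\<in>UNIV. g1 i x * h $ i)) (at x)"
    "\<forall>x. (f2 has_derivative (\<lambda>h. \<Sum>i\<in>UNIV. g2 i x * h $ i)) (at x)" by auto
  have "((\<lambda>x. f1 x + f2 x) has_derivative (\<lambda>h. \<Sum>i\<in>UNIV. (g1 i x + g2 i x) * h $ i)) (at x)" for x
    using has_derivative_add[OF g(3)[rule_format, of x] g(4)[rule_format, of x]]
    by (simp add: distrib_right sum.distrib)
  moreover have "(\<lambda>x. g1 i x + g2 i x) \<in> smooth_algebra" for i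
    using g by (blast intro: smooth_algebra.add)
  ultimately show ?case by (intro exI[of _ "\<lambda>i x. g1 i x + g2 i x"]) auto
next
  case (mult f1 f2)
  then obtain g1 g2 where g: "\<forall>i. g1 i \<in> smooth_algebra" "\<forall>i. g2 i \<in> smooth_algebra"
    "\<forall>x. (f1 has_derivative (\<lambda>h. \<Sum>i\<in>UNIV. g1 i x * h $ i)) (at x)"
    "\<forall>x. (f2 has_derivative (\<lambda>h. \<Sum>i\<in>UNIV. g2 i x * h $ i)) (at x)" by auto
  have "((\<lambda>x. f1 x * f2 x) has_derivative (\<lambda>h. \<Sum>i\<in>UNIV. (f1 x * g2 i x + g1 i x * f2 x) * h $ i)) (at x)" for x
    using has_derivative_mult[OF g(3)[rule_format, of x] g(4)[rule_format, of x]]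
    by (simp add: distrib_right sum.distrib sum_distrib_left sum_distrib_right distrib_left mult_ac)
  moreover have "(\<lambda>x. f1 x * g2 i x + g1 i x * f2 x) \<in> smooth_algebra" for i
    using g mult.hyps by (intro smooth_algebra.add smooth_algebra.mult) auto
  ultimately show ?case by (intro exI[of _ "\<lambda>i x. f1 x * g2 i x + g1 i x * f2 x"]) auto
qed

definition partial :: "'n \<Rightarrow> (real ^ 'n::finite \<Rightarrow> real) \<Rightarrow> real ^ 'n \<Rightarrow> real" where
  "partial i f x = frechet_derivative f (at x) (axis i 1)"

lemma partial_eqI:
  fixes f :: "real ^ 'n::finite \<Rightarrow> real"
  assumes "(f has_derivative (\<lambda>h. \<Sum>i\<in>UNIV. g i x * h $ i)) (at x)"
  shows "partial j f x = g j x"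
proof -
  have "partial j f x = (\<Sum>i\<in>UNIV. g i x * (axis j 1 :: real^'n) $ i)"
    unfolding partial_def by (simp add: frechet_derivative_at[OF assms, symmetric])
  also have "\<dots> = (\<Sum>i\<in>UNIV. if i = j then g j x else 0)"
    by (intro sum.cong) (auto simp: axis_def)
  finally show ?thesis by simp
qed

lemma
  assumes "f \<in> smooth_algebra"
  shows smooth_algebra_partial: "partial i f \<in> smooth_algebra"
    and smooth_algebra_has_derivative:
      "(f has_derivative (\<lambda>h. \<Sum>i\<in>UNIV. partial i f x * h $ i)) (at x)"
proof -
  obtain g where g: "\<And>i. g i \<in> smooth_algebra"
    "\<And>x. (f has_derivative (\<lambda>h. \<Sum>i\<in>UNIV. g i x * h $ i)) (at x)"
    using smooth_algebra_derivative[OF assms] by blast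
  have "partial i f = g i" for i
    by (rule ext, rule partial_eqI, rule g(2))
  then show "partial i f \<in> smooth_algebra"
    "(f has_derivative (\<lambda>h. \<Sum>i\<in>UNIV. partial i f x * h $ i)) (at x)"
    using g by auto
qed

lemma smooth_algebra_continuous:
  assumes "f \<in> smooth_algebra" shows "continuous_on UNIV f"
  using smooth_algebra_has_derivative[OF assms]
  by (meson continuous_at_imp_continuous_on has_derivative_continuous)

text \<open>Closure under partial derivatives is exactly what the induction on the order of
  differentiability requires.\<close>

lemma smooth_algebra_Ck: "f \<in> smooth_algebra \<Longrightarrow> Ck_on k UNIV f"
proof (induction k arbitrary: f)
  case 0 then show ?case by (simp add: smooth_algebra_continuous)
next
  case (Suc k)
  then show ?case
    using smooth_algebra_has_derivative[of f] smooth_algebra_partial[of f]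
    by (auto intro!: exI[of _ "\<lambda>i. partial i f"])
qed

lemma smooth_algebra_translate:
  "f \<in> smooth_algebra \<Longrightarrow> (\<lambda>x. f (x - y)) \<in> smooth_algebra"
proof (induction rule: smooth_algebra.induct)
  case (base p c i a)
  then show ?case using smooth_algebra.base[of p c i "y $ i + a"] by (simp add: algebra_simps)
qed (auto intro: smooth_algebra.intros)

text \<open>Integrals against these particular test functions already determine a locally integrable
  function, and their stability under translation and partial differentiation can be read off from
  the generators of the algebra.\<close>

definition bumps :: "(real ^ 'n::finite \<Rightarrow> real) set" where
  "bumps = {f \<in> smooth_algebra. bounded {x. f x \<noteq> 0}}"

lemma bumps_test_function: "f \<in> bumps \<Longrightarrow> test_function UNIV f"
  by (auto simp: bumps_def test_function_def smooth_algebra_Ck compact_closure)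

lemma bumps_partial:
  assumes "f \<in> bumps" shows "partial i f \<in> bumps"
proof -
  have f: "f \<in> smooth_algebra" "bounded (closure {x. f x \<noteq> 0})"
    using assms by (auto simp: bumps_def)
  have "partial i f x = 0" if "x \<notin> closure {x. f x \<noteq> 0}" for x
  proof -
    have "((\<lambda>x. 0) has_derivative (\<lambda>h. \<Sum>i\<in>UNIV. (0::real) * h $ i)) (at x)" by simp
    then have "(f has_derivative (\<lambda>h. \<Sum>i\<in>UNIV. 0 * h $ i)) (at x)"
    proof (rule has_derivative_transform_within_open)
      show "open (- closure {x. f x \<noteq> 0})" by auto
      show "x \<in> - closure {x. f x \<noteq> 0}" using that by simp
      show "0 = f z" if "z \<in> - closure {x. f x \<noteq> 0}" for z
        using that closure_subset[of "{x. f x \<noteq> 0}"] by auto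
    qed
    from partial_eqI[OF this] show ?thesis .
  qed
  then have "{x. partial i f x \<noteq> 0} \<subseteq> closure {x. f x \<noteq> 0}" by blast
  then show ?thesis
    using f smooth_algebra_partial[OF f(1)] bounded_subset by (auto simp: bumps_def)
qed

lemma bumps_translate:
  assumes "f \<in> bumps" shows "(\<lambda>x. f (x - y)) \<in> bumps"
proof -
  have "{x. f (x - y) \<noteq> 0} = (\<lambda>x. x + y) ` {x. f x \<noteq> 0}"
    by (auto intro!: image_eqI[where x = "x - y" for x])
  then show ?thesis using assms
    by (auto simp: bumps_def smooth_algebra_translate bounded_translation_minus add.commute[of _ y] intro: bounded_translation)
qed

lemma partial_translate:
  assumes "f \<in> bumps" shows "partial i (\<lambda>x. f (x - y)) x = partial i f (x - y)"
proof (rule partial_eqI)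
  have "f \<in> smooth_algebra" using assms by (simp add: bumps_def)
  from has_derivative_compose[OF _ smooth_algebra_has_derivative[OF this], of "\<lambda>x. x - y" "\<lambda>h. h" x UNIV]
  show "((\<lambda>x. f (x - y)) has_derivative (\<lambda>h. \<Sum>i\<in>UNIV. partial i f (x - y) * h $ i)) (at x)"
    by (fastforce intro!: derivative_eq_intros)
qed

lemma bumps_bounded:
  assumes "f \<in> bumps" obtains C where "C \<ge> 0" "\<And>x. \<bar>f x\<bar> \<le> C"
proof -
  let ?K = "closure {x. f x \<noteq> 0}"
  have "compact ?K" "continuous_on ?K f"
    using assms continuous_on_subset[OF smooth_algebra_continuous]
    by (auto simp: bumps_def compact_closure)
  then have "bounded (f ` ?K)" by (simp add: compact_continuous_image compact_imp_bounded)
  then obtain C where C: "C > 0" "\<And>x. x \<in> ?K \<Longrightarrow> \<bar>f x\<bar> \<le> C"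
    by (auto simp: bounded_pos)
  have "\<bar>f x\<bar> \<le> C" for x
    using C closure_subset[of "{x. f x \<noteq> 0}"] by (cases "f x = 0") auto
  then show ?thesis using that C(1) by (meson less_imp_le)
qed


section \<open>The fundamental lemma of the calculus of variations\<close>

text \<open>Borel rather than Lebesgue measurability, since Lebesgue measurability is not preserved under the
  passage to \<open>\<lambda>(x, y). v (x + y)\<close> on the product measure space, which is not complete.\<close>

definition locally_integrable :: "(real ^ 'n::finite \<Rightarrow> complex) \<Rightarrow> bool" where
  "locally_integrable v \<longleftrightarrow> v \<in> borel_measurable borel \<and> (\<forall>K. compact K \<longrightarrow> set_integrable lborel K v)"

lemma bumps_measurable [measurable_dest]: "f \<in> bumps \<Longrightarrow> f \<in> borel_measurable borel"
  by (auto simp: bumps_def intro: borel_measurable_continuous_onI smooth_algebra_continuous)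

lemma integrable_bounded_support:
  fixes f :: "real ^ 'n::finite \<Rightarrow> real"
  assumes "f \<in> borel_measurable borel" "bounded {x. f x \<noteq> 0}" "\<And>x. \<bar>f x\<bar> \<le> C"
    and v: "locally_integrable v"
  shows "integrable lborel (\<lambda>x. f x *\<^sub>R v x)"
proof (rule Bochner_Integration.integrable_bound)
  let ?K = "closure {x. f x \<noteq> 0}"
  have "integrable lborel (\<lambda>x. indicator ?K x *\<^sub>R v x)"
    using v assms(2) by (auto simp: locally_integrable_def set_integrable_def compact_closure)
  then show "integrable lborel (\<lambda>x. C *\<^sub>R (indicator ?K x *\<^sub>R v x))"
    by (rule integrable_scaleR_right)
  show "(\<lambda>x. f x *\<^sub>R v x) \<in> borel_measurable lborel"
    using v assms(1) by (auto simp: locally_integrable_def)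
  have "norm (f x *\<^sub>R v x) \<le> norm (C *\<^sub>R (indicator ?K x *\<^sub>R v x))" for x
  proof (cases "f x = 0")
    case False
    then have "x \<in> ?K" using closure_subset[of "{x. f x \<noteq> 0}"] by auto
    then show ?thesis using assms(3)[of x] by (auto intro!: mult_right_mono)
  qed auto
  then show "AE x in lborel. norm (f x *\<^sub>R v x) \<le> norm (C *\<^sub>R (indicator ?K x *\<^sub>R v x))" by simp
qed

lemma bumps_integrable:
  assumes "f \<in> bumps" "locally_integrable v"
  shows "integrable lborel (\<lambda>x. f x *\<^sub>R v x)"
proof -
  obtain C where "\<And>x. \<bar>f x\<bar> \<le> C" using bumps_bounded[OF assms(1)] by blast
  then show ?thesis
    using assms bumps_measurable[OF assms(1)]
    by (intro integrable_bounded_support) (auto simp: bumps_def)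
qed

text \<open>As \<open>k\<close> grows, these bumps converge to the indicator function of the box: every factor with a
  positive argument tends to \<open>exp 0\<close>, and outside the box some factor is zero.\<close>

definition box_cutoff :: "real ^ 'n::finite \<Rightarrow> real ^ 'n \<Rightarrow> real \<Rightarrow> real ^ 'n \<Rightarrow> real" where
  "box_cutoff a b k x = (\<Prod>i\<in>UNIV. flat 1 (k * (x $ i - a $ i)) * flat 1 (- k * (x $ i - b $ i)))"

lemma flat_1_le: "0 \<le> flat 1 t" "flat 1 t \<le> 1"
  by (auto simp: flat_def)

lemma box_cutoff_bounds: "0 \<le> box_cutoff a b k x" "box_cutoff a b k x \<le> 1"
  unfolding box_cutoff_def
  by (auto intro!: prod_nonneg prod_le_1 mult_le_one simp: flat_1_le)

lemma box_cutoff_outside: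
  assumes "k > 0" "x \<notin> box a b" shows "box_cutoff a b k x = 0"
proof -
  obtain i where "x $ i \<le> a $ i \<or> b $ i \<le> x $ i"
    using assms(2) by (auto simp: mem_box_cart not_less)
  then have "k * (x $ i - a $ i) \<le> 0 \<or> - k * (x $ i - b $ i) \<le> 0"
    using assms(1) by (auto simp: mult_le_0_iff)
  then have "flat 1 (k * (x $ i - a $ i)) * flat 1 (- k * (x $ i - b $ i)) = 0"
    by (auto simp: flat_def)
  then show ?thesis unfolding box_cutoff_def by (intro prod_zero) auto
qed

lemma box_cutoff_bumps:
  assumes "k > 0" shows "box_cutoff a b k \<in> bumps"
proof -
  have "box_cutoff a b k \<in> smooth_algebra"
    unfolding box_cutoff_def[abs_def]
    by (intro smooth_algebra_prod smooth_algebra.mult smooth_algebra.base) auto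
  moreover have "{x. box_cutoff a b k x \<noteq> 0} \<subseteq> box a b"
    using box_cutoff_outside[OF assms] by auto
  ultimately show ?thesis using bounded_subset[OF bounded_box] by (auto simp: bumps_def)
qed

lemma flat_1_tendsto:
  assumes "t > 0" shows "(\<lambda>m. flat 1 (real (Suc m) * t)) \<longlonglongrightarrow> 1"
proof -
  have "(\<lambda>m. exp (- (inverse (real (Suc m)) * inverse t))) \<longlonglongrightarrow> exp (- (0 * inverse t))"
    by (intro tendsto_intros LIMSEQ_inverse_real_of_nat)
  then show ?thesis using assms by (simp add: flat_def divide_inverse)
qed

lemma box_cutoff_tendsto:
  "(\<lambda>m. box_cutoff a b (real (Suc m)) x) \<longlonglongrightarrow> indicator (box a b) x"
proof (cases "x \<in> box a b")
  case True
  have "(\<lambda>m. flat 1 (real (Suc m) * (x $ i - a $ i)) * flat 1 (- real (Suc m) * (x $ i - b $ i))) \<longlonglongrightarrow> 1 * 1" for i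
    using True flat_1_tendsto[of "x $ i - a $ i"] flat_1_tendsto[of "b $ i - x $ i"]
    by (intro tendsto_mult) (auto simp: mem_box_cart algebra_simps)
  then have "(\<lambda>m. box_cutoff a b (real (Suc m)) x) \<longlonglongrightarrow> (\<Prod>i\<in>(UNIV::'a set). 1 * 1)"
    unfolding box_cutoff_def by (intro tendsto_prod) auto
  then show ?thesis using True by simp
qed (simp add: box_cutoff_outside)

text \<open>Dominated convergence applied to the cutoffs of the box; the indicator of the closed box
  supplies the bound.\<close>

lemma box_integral_zero:
  assumes v: "locally_integrable v"
    and zero: "\<And>f. f \<in> bumps \<Longrightarrow> (LINT x|lborel. f x *\<^sub>R v x) = 0"
  shows "(LINT x:box a b|lborel. v x) = 0"
proof -
  have [measurable]: "v \<in> borel_measurable borel" using v by (simp add: locally_integrable_def)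
  have [measurable]: "box_cutoff a b (real (Suc m)) \<in> borel_measurable borel" for m
    by (rule bumps_measurable[OF box_cutoff_bumps]) simp
  have "(\<lambda>m. LINT x|lborel. box_cutoff a b (real (Suc m)) x *\<^sub>R v x)
      \<longlonglongrightarrow> (LINT x|lborel. indicator (box a b) x *\<^sub>R v x)"
  proof (rule integral_dominated_convergence[where w = "\<lambda>x. norm (indicator (cbox a b) x *\<^sub>R v x)"])
    show "integrable lborel (\<lambda>x. norm (indicator (cbox a b) x *\<^sub>R v x))"
      using v unfolding locally_integrable_def set_integrable_def
      by (intro integrable_norm) auto
    show "AE x in lborel. (\<lambda>m. box_cutoff a b (real (Suc m)) x *\<^sub>R v x)
        \<longlonglongrightarrow> indicator (box a b) x *\<^sub>R v x"
      by (intro AE_I2 tendsto_intros box_cutoff_tendsto)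
    show "AE x in lborel. norm (box_cutoff a b (real (Suc m)) x *\<^sub>R v x)
        \<le> norm (indicator (cbox a b) x *\<^sub>R v x)" for m
    proof (rule AE_I2)
      fix x
      show "norm (box_cutoff a b (real (Suc m)) x *\<^sub>R v x) \<le> norm (indicator (cbox a b) x *\<^sub>R v x)"
        using box_cutoff_bounds[of a b "real (Suc m)" x] box_cutoff_outside[of "real (Suc m)" x a b]
          box_subset_cbox[of a b]
        by (cases "x \<in> box a b") (auto intro!: mult_left_le_one_le simp: subset_eq simp del: of_nat_Suc)
    qed
  qed measurable
  moreover have "(LINT x|lborel. box_cutoff a b (real (Suc m)) x *\<^sub>R v x) = 0" for m
    by (rule zero[OF box_cutoff_bumps]) simp
  ultimately show ?thesis
    unfolding set_lebesgue_integral_def by (simp only: LIMSEQ_const_iff)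
qed

text \<open>Boxes form an intersection-stable generator of the Borel sets, and the Borel sets over which the
  integral vanishes are closed under complements and disjoint countable unions; the assumption
  on the whole space is needed for complements.\<close>

lemma AE_zero_if_box_integrals_zero:
  fixes w :: "'a::euclidean_space \<Rightarrow> complex"
  assumes w: "integrable lborel w" and zero: "\<And>a b. (LINT x:box a b|lborel. w x) = 0"
    and total: "(LINT x|lborel. w x) = 0"
  shows "AE x in lborel. w x = 0"
proof (rule sigma_finite_measure.density_zero[OF sigma_finite_lborel w])
  fix A :: "'a set" assume "A \<in> sets lborel"
  then have "A \<in> sigma_sets UNIV (range (\<lambda>(a, b). box a b))"
    by (simp add: borel_eq_box)
  then show "(LINT x:A|lborel. w x) = 0"
  proof (induction rule: sigma_sets_induct_disjoint[rotated 2, consumes 1, case_names basic empty compl union])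
    case (basic A) then show ?case using zero by auto
  next
    case empty show ?case by (simp add: set_lebesgue_integral_def)
  next
    case (compl A)
    then have "A \<in> sets lborel" by (simp add: borel_eq_box)
    then have "(LINT x:A \<union> (UNIV - A)|lborel. w x) = (LINT x:A|lborel. w x) + (LINT x:UNIV - A|lborel. w x)"
      by (intro set_integral_Un) (auto simp: set_integrable_def intro!: integrable_mult_indicator w)
    then show ?case using compl total by (simp add: set_lebesgue_integral_def)
  next
    case (union A)
    have "range A \<subseteq> sets lborel" using union by (auto simp: borel_eq_box)
    then have "(LINT x:(\<Union>i. A i)|lborel. w x) = (\<Sum>i. LINT x:A i|lborel. w x)"
      using union by (intro lebesgue_integral_countable_add)
        (auto simp: set_integrable_def disjoint_family_on_def intro!: integrable_mult_indicator w)
    then show ?case using union by simp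
  next
    show "Int_stable (range (\<lambda>(a, b). box a b :: 'a set))"
      by (auto simp: Int_stable_def box_Int_box)
    show "range (\<lambda>(a, b). box a b :: 'a set) \<subseteq> Pow UNIV" by auto
  qed
qed

text \<open>A locally integrable function becomes integrable when it is cut off to a large cube, and its
  integrals over boxes still vanish because the intersection of two boxes is a box.\<close>

lemma AE_zero_if_orthogonal_to_bumps:
  assumes v: "locally_integrable v"
    and zero: "\<And>f. f \<in> bumps \<Longrightarrow> (LINT x|lborel. f x *\<^sub>R v x) = 0"
  shows "AE x in lborel. v x = 0"
proof -
  define Q where "Q m = box (- (\<chi> i. real m)) (\<chi> i. real m :: real ^ 'a)" for m :: nat
  have "AE x in lborel. indicator (Q m) x *\<^sub>R v x = 0" for m
  proof (rule AE_zero_if_box_integrals_zero)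
    have "set_integrable lborel (cbox (- (\<chi> i. real m)) (\<chi> i. real m)) v"
      using v by (simp add: locally_integrable_def)
    then have "set_integrable lborel (Q m) v"
      by (rule set_integrable_subset) (auto simp: Q_def box_subset_cbox)
    then show "integrable lborel (\<lambda>x. indicator (Q m) x *\<^sub>R v x)"
      by (simp add: set_integrable_def)
    show "(LINT x|lborel. indicator (Q m) x *\<^sub>R v x) = 0"
      using box_integral_zero[OF assms, of "- (\<chi> i. real m)" "\<chi> i. real m"]
      by (simp add: set_lebesgue_integral_def Q_def)
    show "(LINT x:box a b|lborel. indicator (Q m) x *\<^sub>R v x) = 0" for a b
    proof -
      obtain c d where "box a b \<inter> Q m = box c d" unfolding Q_def box_Int_box by blast
      then have "indicator (box a b) x *\<^sub>R indicator (Q m) x *\<^sub>R v x = indicator (box c d) x *\<^sub>R v x" for x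
        by (metis indicator_inter_arith scaleR_scaleR)
      then show ?thesis
        using box_integral_zero[OF assms, of c d]
        by (simp only: set_lebesgue_integral_def)
    qed
  qed
  then have "AE x in lborel. \<forall>m. indicator (Q m) x *\<^sub>R v x = 0"
    unfolding AE_all_countable by blast
  then show ?thesis
  proof eventually_elim
    case (elim x)
    obtain m :: nat where m: "norm x < real m" using reals_Archimedean2 by blast
    have "- real m < x $ i" "x $ i < real m" for i
      using m component_le_norm_cart[of x i] by linarith+
    then have "x \<in> Q m"
      by (simp add: Q_def mem_box_cart)
    then show ?case using elim by (metis indicator_simps(1) scaleR_one)
  qed
qed

section \<open>Functions with vanishing weak gradient\<close>

lemma lborel_integral_translate:
  fixes f :: "'a::euclidean_space \<Rightarrow> 'b::{banach, second_countable_topology}"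
  assumes "f \<in> borel_measurable borel"
  shows "(LINT x|lborel. f (x + p)) = (LINT x|lborel. f x)"
proof -
  have "(LINT x|lborel. f x) = (LINT x|distr lborel borel ((+) p). f x)"
    by (simp add: lborel_distr_plus)
  also have "\<dots> = (LINT x|lborel. f (p + x))"
    using assms by (subst integral_distr) auto
  finally show ?thesis by (simp add: add.commute)
qed

text \<open>Differentiation under the integral sign: the derivative of the translated bump is a linear
  combination of partial derivatives of bumps, against which \<open>v\<close> integrates to zero.\<close>

lemma integral_translated_bump_derivative_zero:
  assumes f: "f \<in> bumps"
    and v: "locally_integrable v"
    and zero: "\<And>f i. f \<in> bumps \<Longrightarrow> (LINT x|lborel. partial i f x *\<^sub>R v x) = 0"
  shows "((\<lambda>s. LINT x|lborel. f (x - s *\<^sub>R y) *\<^sub>R v x) has_vector_derivative 0) (at s)"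
proof -
  define F where "F s = (LINT x|lborel. f (x - s *\<^sub>R y) *\<^sub>R v x)" for s
  define f' where "f' x = (\<Sum>i\<in>UNIV. partial i f x * - y $ i)" for x
  have [measurable]: "v \<in> borel_measurable borel" using v by (simp add: locally_integrable_def)
  have [measurable]: "f \<in> borel_measurable borel" "partial i f \<in> borel_measurable borel" for i
    using f bumps_partial bumps_measurable by blast+
  have [measurable]: "f' \<in> borel_measurable borel" unfolding f'_def[abs_def] by measurable
  have fs: "f \<in> smooth_algebra" "bounded {x. f x \<noteq> 0}" using f by (auto simp: bumps_def)
  have int: "integrable lborel (\<lambda>x. f (x - s *\<^sub>R y) *\<^sub>R v x)" for s
    by (rule bumps_integrable[OF bumps_translate[OF f] v])
  have deriv: "((\<lambda>s. f (x - s *\<^sub>R y)) has_real_derivative f' (x - s *\<^sub>R y)) (at s)" for x s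
  proof -
    have "((\<lambda>s. x - s *\<^sub>R y) has_derivative (\<lambda>h. - (h *\<^sub>R y))) (at s)"
      by (auto intro!: derivative_eq_intros)
    from has_derivative_compose[OF this smooth_algebra_has_derivative[OF fs(1)]]
    show ?thesis
      unfolding has_field_derivative_def f'_def
      by (rule has_derivative_eq_rhs) (auto simp: sum_distrib_left sum_distrib_right algebra_simps)
  qed
  obtain C where C: "C \<ge> 0" "\<And>x. \<bar>f' x\<bar> \<le> C"
  proof -
    have "\<exists>C. \<forall>x. \<bar>partial i f x\<bar> \<le> C" for i
      using bumps_bounded[OF bumps_partial[OF f]] by metis
    then obtain B where B: "\<And>i x. \<bar>partial i f x\<bar> \<le> B i" by metis
    have "\<bar>f' x\<bar> \<le> (\<Sum>i\<in>UNIV. B i * \<bar>y $ i\<bar>)" for x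
      unfolding f'_def by (rule order_trans[OF sum_abs]) (auto intro!: sum_mono mult_right_mono B simp: abs_mult)
    then show ?thesis using that by (meson abs_ge_zero order_trans)
  qed
  \<comment> \<open>The difference quotients are bounded by the bound on the derivative, and for bounded shifts
    they all live on a common ball, so a multiple of \<open>norm (v x)\<close> on that ball dominates them.\<close>
  have lip: "\<bar>f (x - t *\<^sub>R y) - f (x - s *\<^sub>R y)\<bar> \<le> C * \<bar>t - s\<bar>" for x s t
    using field_differentiable_bound[of UNIV "\<lambda>s. f (x - s *\<^sub>R y)" "\<lambda>s. f' (x - s *\<^sub>R y)" C t s]
      deriv C by auto
  have F'0: "(LINT x|lborel. f' (x - s *\<^sub>R y) *\<^sub>R v x) = 0"
  proof -
    have "(LINT x|lborel. f' (x - s *\<^sub>R y) *\<^sub>R v x) =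
        (LINT x|lborel. (\<Sum>i\<in>UNIV. (- y $ i) *\<^sub>R (partial i (\<lambda>x. f (x - s *\<^sub>R y)) x *\<^sub>R v x)))"
      by (simp add: f'_def scaleR_sum_left partial_translate[OF f] mult.commute)
    also have "\<dots> = 0"
      using zero[OF bumps_translate[OF f]]
      by (subst Bochner_Integration.integral_sum)
        (intro integrable_scaleR_right bumps_integrable bumps_partial bumps_translate f v,
         simp only: integral_scaleR_right scaleR_zero_right sum.neutral_const)
    finally show ?thesis .
  qed
  have "((\<lambda>t. (F t - F s) /\<^sub>R (t - s)) \<longlongrightarrow> 0) (at s)"
  proof (subst tendsto_at_iff_sequentially, safe)
    fix X :: "nat \<Rightarrow> real" assume X: "\<forall>i. X i \<in> UNIV - {s}" "X \<longlonglongrightarrow> s"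
    obtain R where R: "R > 0" "\<And>x. f x \<noteq> 0 \<Longrightarrow> norm x \<le> R"
      using fs(2) by (auto simp: bounded_pos)
    obtain M where M: "M > 0" "\<And>i. \<bar>X i\<bar> \<le> M"
      using X(2) convergent_imp_bounded[of X s] by (auto simp: bounded_pos)
    let ?K = "cball 0 (R + (M + \<bar>s\<bar>) * norm y) :: (real ^ 'a) set"
    have supp: "f (x - t *\<^sub>R y) = 0" if "\<bar>t\<bar> \<le> M + \<bar>s\<bar>" "x \<notin> ?K" for x t
    proof (rule ccontr)
      assume "f (x - t *\<^sub>R y) \<noteq> 0"
      then have "norm (x - t *\<^sub>R y) \<le> R" using R by blast
      moreover have "norm x \<le> norm (x - t *\<^sub>R y) + norm (t *\<^sub>R y)"
        by (metis add.commute diff_add_cancel norm_triangle_ineq)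
      moreover have "norm (t *\<^sub>R y) \<le> (M + \<bar>s\<bar>) * norm y" using that by (auto intro!: mult_right_mono)
      ultimately show False using that by auto
    qed
    have "(\<lambda>n. LINT x|lborel. ((f (x - X n *\<^sub>R y) - f (x - s *\<^sub>R y)) / (X n - s)) *\<^sub>R v x)
        \<longlonglongrightarrow> (LINT x|lborel. f' (x - s *\<^sub>R y) *\<^sub>R v x)"
    proof (rule integral_dominated_convergence[where w = "\<lambda>x. C * norm (indicator ?K x *\<^sub>R v x)"])
      show "integrable lborel (\<lambda>x. C * norm (indicator ?K x *\<^sub>R v x))"
        using v unfolding locally_integrable_def set_integrable_def
        by (intro integrable_mult_right integrable_norm) auto
      show "AE x in lborel. (\<lambda>n. ((f (x - X n *\<^sub>R y) - f (x - s *\<^sub>R y)) / (X n - s)) *\<^sub>R v x)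
          \<longlonglongrightarrow> f' (x - s *\<^sub>R y) *\<^sub>R v x"
      proof (intro AE_I2 tendsto_scaleR tendsto_const)
        fix x
        show "(\<lambda>n. (f (x - X n *\<^sub>R y) - f (x - s *\<^sub>R y)) / (X n - s)) \<longlonglongrightarrow> f' (x - s *\<^sub>R y)"
          using deriv[of x s] X unfolding has_field_derivative_iff tendsto_at_iff_sequentially
          by (auto simp: o_def)
      qed
      show "AE x in lborel. norm (((f (x - X n *\<^sub>R y) - f (x - s *\<^sub>R y)) / (X n - s)) *\<^sub>R v x)
          \<le> C * norm (indicator ?K x *\<^sub>R v x)" for n
      proof (rule AE_I2)
        fix x
        have ne: "X n \<noteq> s" using X by auto
        have "\<bar>(f (x - X n *\<^sub>R y) - f (x - s *\<^sub>R y)) / (X n - s)\<bar> \<le> C"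
          using lip[of x "X n" s] ne by (simp add: abs_divide divide_le_eq)
        moreover have "f (x - X n *\<^sub>R y) = 0" "f (x - s *\<^sub>R y) = 0" if "x \<notin> ?K"
          using supp[OF _ that] M(1) M(2)[of n] by auto
        ultimately show "norm (((f (x - X n *\<^sub>R y) - f (x - s *\<^sub>R y)) / (X n - s)) *\<^sub>R v x)
          \<le> C * norm (indicator ?K x *\<^sub>R v x)"
          by (cases "x \<in> ?K") (auto intro!: mult_right_mono simp del: abs_divide times_divide_eq_left)
      qed
    qed measurable
    moreover have "(LINT x|lborel. ((f (x - X n *\<^sub>R y) - f (x - s *\<^sub>R y)) / (X n - s)) *\<^sub>R v x) =
        (F (X n) - F s) /\<^sub>R (X n - s)" for n
    proof -
      have "(LINT x|lborel. ((f (x - X n *\<^sub>R y) - f (x - s *\<^sub>R y)) / (X n - s)) *\<^sub>R v x) =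
        (LINT x|lborel. inverse (X n - s) *\<^sub>R (f (x - X n *\<^sub>R y) *\<^sub>R v x - f (x - s *\<^sub>R y) *\<^sub>R v x))"
        by (simp only: divide_inverse mult.commute[of _ "inverse (X n - s)"] scaleR_scaleR[symmetric] scaleR_diff_left)
      then show ?thesis
        unfolding F_def by (simp only: integral_scaleR_right Bochner_Integration.integral_diff[OF int int])
    qed
    ultimately show "((\<lambda>t. (F t - F s) /\<^sub>R (t - s)) \<circ> X) \<longlonglongrightarrow> 0"
      by (simp add: F'0 o_def)
  qed
  then have "((\<lambda>t. norm ((F t - F s) /\<^sub>R (t - s))) \<longlongrightarrow> 0) (at s)"
    by (rule tendsto_norm_zero)
  then show ?thesis
    unfolding F_def[symmetric, abs_def] has_vector_derivative_def has_derivative_iff_norm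
    by (simp add: bounded_linear_zero divide_inverse mult.commute abs_inverse)
qed

lemma integral_translate_bump_constant:
  assumes f: "f \<in> bumps"
    and v: "locally_integrable v"
    and zero: "\<And>f i. f \<in> bumps \<Longrightarrow> (LINT x|lborel. partial i f x *\<^sub>R v x) = 0"
  shows "(LINT x|lborel. f (x - y) *\<^sub>R v x) = (LINT x|lborel. f x *\<^sub>R v x)"
proof -
  obtain c where "\<And>s. (LINT x|lborel. f (x - s *\<^sub>R y) *\<^sub>R v x) = c"
    by (rule has_vector_derivative_zero_constant[OF convex_UNIV])
      (use integral_translated_bump_derivative_zero[OF assms] in auto)
  from this[of 1] this[of 0] show ?thesis by simp
qed

lemma locally_integrable_translate:
  assumes "locally_integrable v" shows "locally_integrable (\<lambda>x. v (x + p))"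
proof -
  have [measurable]: "v \<in> borel_measurable borel" using assms by (simp add: locally_integrable_def)
  have "set_integrable lborel K (\<lambda>x. v (x + p))" if K: "compact K" for K
  proof -
    have [measurable]: "K \<in> sets borel" using K by (simp add: borel_compact)
    have K': "compact ((\<lambda>x. x + p) ` K)"
      using K by (intro compact_continuous_image continuous_intros)
    then have [measurable]: "(\<lambda>x. x + p) ` K \<in> sets borel" by (simp add: borel_compact)
    have "integrable (distr lborel borel ((+) p)) (\<lambda>x. indicator ((\<lambda>x. x + p) ` K) x *\<^sub>R v x)"
      using assms K' by (simp add: locally_integrable_def set_integrable_def lborel_distr_plus)
    then have "integrable lborel (\<lambda>x. indicator ((\<lambda>x. x + p) ` K) (p + x) *\<^sub>R v (p + x))"
      by (subst (asm) integrable_distr_eq) auto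
    moreover have "indicator ((\<lambda>x. x + p) ` K) (p + x) = (indicator K x :: real)" for x
      by (auto simp: indicator_def add.commute)
    ultimately show ?thesis by (simp add: set_integrable_def add.commute)
  qed
  then show ?thesis by (auto simp: locally_integrable_def)
qed

lemma locally_integrable_diff:
  "locally_integrable v \<Longrightarrow> locally_integrable w \<Longrightarrow> locally_integrable (\<lambda>x. v x - w x)"
  by (auto simp: locally_integrable_def set_integral_diff)

lemma locally_integrable_mult_left:
  "locally_integrable v \<Longrightarrow> locally_integrable (\<lambda>x. c * v x)"
  by (auto simp: locally_integrable_def)

lemma bump_integral_translate:
  assumes f: "f \<in> bumps" and v: "locally_integrable v"
  shows "(LINT x|lborel. f (x - y) *\<^sub>R v x) = (LINT x|lborel. f x *\<^sub>R v (x + y))"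
proof -
  have [measurable]: "v \<in> borel_measurable borel" using v by (simp add: locally_integrable_def)
  have [measurable]: "f \<in> borel_measurable borel" by (rule bumps_measurable[OF f])
  show ?thesis
    using lborel_integral_translate[of "\<lambda>x. f (x - y) *\<^sub>R v x" y] by simp
qed

lemma AE_lborel_witness:
  assumes "AE x in lborel. P x" obtains x where "P x"
  using eventually_happens'[OF _ assms] by (auto simp: ae_filter_eq_bot_iff emeasure_lborel_UNIV)

text \<open>Each single translation leaves \<open>v\<close> unchanged almost everywhere, with an exceptional null set that
  depends on the translation. Fubini's theorem exchanges the roles: there is one point \<open>x\<close> such that
  \<open>v (x + y) = v x\<close> for almost every \<open>y\<close>, which says that \<open>v\<close> is constant almost everywhere.\<close>

lemma AE_constant_if_weak_gradient_zero:
  fixes v :: "real ^ 'n::finite \<Rightarrow> complex"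
  assumes v: "locally_integrable v"
    and zero: "\<And>f i. f \<in> bumps \<Longrightarrow> (LINT x|lborel. partial i f x *\<^sub>R v x) = 0"
  shows "\<exists>c. AE x in lborel. v x = c"
proof -
  have [measurable]: "v \<in> borel_measurable borel" using v by (simp add: locally_integrable_def)
  have shift: "AE x in lborel. v (x + y) = v x" for y
  proof -
    have "AE x in lborel. v (x + y) - v x = 0"
    proof (rule AE_zero_if_orthogonal_to_bumps)
      show "locally_integrable (\<lambda>x. v (x + y) - v x)"
        by (intro locally_integrable_diff locally_integrable_translate v)
      fix f :: "real ^ 'n \<Rightarrow> real" assume f: "f \<in> bumps"
      have "(LINT x|lborel. f x *\<^sub>R (v (x + y) - v x)) =
          (LINT x|lborel. f x *\<^sub>R v (x + y)) - (LINT x|lborel. f x *\<^sub>R v x)"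
        unfolding scaleR_diff_right
        by (intro Bochner_Integration.integral_diff bumps_integrable f locally_integrable_translate v)
      then show "(LINT x|lborel. f x *\<^sub>R (v (x + y) - v x)) = 0"
        using integral_translate_bump_constant[OF f v zero, of y] bump_integral_translate[OF f v, of y]
        by simp
    qed
    then show ?thesis by simp
  qed
  have "AE y in lborel. AE x in lborel. v (x + y) = v x" using shift by simp
  moreover have "{z \<in> space (lborel \<Otimes>\<^sub>M lborel). v (fst z + snd z) = v (fst z)} \<in> sets (lborel \<Otimes>\<^sub>M lborel)"
    by measurable
  ultimately have "AE x in lborel. AE y in lborel. v (x + y) = v x"
    using lborel_pair.AE_commute[of "\<lambda>x y. v (x + y) = v x"] by simp
  then obtain x where x: "AE y in lborel. v (x + y) = v x"
    by (rule AE_lborel_witness)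
  then have "AE y in distr lborel borel ((+) x). v y = v x"
    by (subst AE_distr_iff) auto
  then have "AE y in lborel. v y = v x" unfolding lborel_distr_plus .
  then show ?thesis by blast
qed


section \<open>Uniqueness of weak gradients\<close>

text \<open>The weak gradient relation in terms of Borel representatives, tested against bumps only.\<close>

definition has_weak_partials ::
    "(real ^ 'n::finite \<Rightarrow> complex) \<Rightarrow> ('n \<Rightarrow> real ^ 'n \<Rightarrow> complex) \<Rightarrow> bool" where
  "has_weak_partials v G \<longleftrightarrow> locally_integrable v \<and> (\<forall>i. locally_integrable (G i) \<and>
     (\<forall>f\<in>bumps. (LINT x|lborel. partial i f x *\<^sub>R v x) = - (LINT x|lborel. f x *\<^sub>R G i x)))"

text \<open>The factor \<open>c\<close> covers both uses at once: the eigenvalue equation, and the quasi-periodicity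
  relation between a function and its translate.\<close>

lemma has_weak_partials_unique:
  fixes v w :: "real ^ 'n::finite \<Rightarrow> complex"
  assumes v: "has_weak_partials v G" and w: "has_weak_partials w H"
    and eq: "AE x in lborel. v x = c * w x"
  shows "AE x in lborel. G i x = c * H i x"
proof -
  have li: "locally_integrable v" "locally_integrable w" "locally_integrable (G i)" "locally_integrable (H i)"
    using v w by (auto simp: has_weak_partials_def)
  then have [measurable]: "v \<in> borel_measurable borel" "w \<in> borel_measurable borel"
    by (auto simp: locally_integrable_def)
  have "AE x in lborel. G i x - c * H i x = 0"
  proof (rule AE_zero_if_orthogonal_to_bumps)
    show "locally_integrable (\<lambda>x. G i x - c * H i x)"
      by (intro locally_integrable_diff locally_integrable_mult_left li)
    fix f :: "real ^ 'n \<Rightarrow> real" assume f: "f \<in> bumps"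
    have [measurable]: "partial i f \<in> borel_measurable borel"
      by (rule bumps_measurable[OF bumps_partial[OF f]])
    have "(LINT x|lborel. f x *\<^sub>R (G i x - c * H i x)) =
        (LINT x|lborel. f x *\<^sub>R G i x) - (LINT x|lborel. c * (f x *\<^sub>R H i x))"
      unfolding scaleR_diff_right mult_scaleR_right
      by (intro Bochner_Integration.integral_diff bumps_integrable f li locally_integrable_mult_left)
    also have "\<dots> = (LINT x|lborel. f x *\<^sub>R G i x) - c * (LINT x|lborel. f x *\<^sub>R H i x)"
      by (simp only: integral_mult_right_zero)
    also have "\<dots> = c * (LINT x|lborel. partial i f x *\<^sub>R w x) - (LINT x|lborel. partial i f x *\<^sub>R v x)"
      using v w f by (simp add: has_weak_partials_def)
    also have "(LINT x|lborel. partial i f x *\<^sub>R v x) = (LINT x|lborel. c * (partial i f x *\<^sub>R w x))"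
      using eq by (intro integral_cong_AE) (auto elim!: eventually_mono)
    also have "\<dots> = c * (LINT x|lborel. partial i f x *\<^sub>R w x)"
      by (simp only: integral_mult_right_zero)
    finally show "(LINT x|lborel. f x *\<^sub>R (G i x - c * H i x)) = 0" by simp
  qed
  then show ?thesis by simp
qed

lemma has_weak_partials_translate:
  assumes "has_weak_partials v G"
  shows "has_weak_partials (\<lambda>x. v (x + p)) (\<lambda>i x. G i (x + p))"
  unfolding has_weak_partials_def
proof (intro conjI allI ballI)
  fix i and f :: "real ^ 'a \<Rightarrow> real" assume f: "f \<in> bumps"
  have v: "locally_integrable v" and G: "locally_integrable (G i)" and
    wp: "\<And>f. f \<in> bumps \<Longrightarrow> (LINT x|lborel. partial i f x *\<^sub>R v x) = - (LINT x|lborel. f x *\<^sub>R G i x)"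
    using assms by (auto simp: has_weak_partials_def)
  have "(LINT x|lborel. partial i f x *\<^sub>R v (x + p)) = (LINT x|lborel. partial i (\<lambda>x. f (x - p)) x *\<^sub>R v x)"
    by (simp add: partial_translate[OF f] bump_integral_translate[OF bumps_partial[OF f] v])
  also have "\<dots> = - (LINT x|lborel. f x *\<^sub>R G i (x + p))"
    using wp[OF bumps_translate[OF f], of p] bump_integral_translate[OF f G] by simp
  finally show "(LINT x|lborel. partial i f x *\<^sub>R v (x + p)) = - (LINT x|lborel. f x *\<^sub>R G i (x + p))" .
qed (use assms in \<open>auto simp: has_weak_partials_def intro: locally_integrable_translate\<close>)

lemma L2_loc_component:
  assumes "L2_loc g" shows "L2_loc (\<lambda>x. g x $ i)"
  unfolding L2_loc_def
proof (intro conjI allI impI)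
  have "g \<in> borel_measurable lebesgue" using assms by (simp add: L2_loc_def)
  then show meas: "(\<lambda>x. g x $ i) \<in> borel_measurable lebesgue"
    by (rule borel_measurable_continuous_on[rotated]) (intro continuous_intros)
  fix K :: "(real^'a) set" assume K: "compact K"
  show "set_integrable lebesgue K (\<lambda>x. (norm (g x $ i))\<^sup>2)"
  proof (rule set_integrable_bound)
    show "set_integrable lebesgue K (\<lambda>x. (norm (g x))\<^sup>2)" using assms K by (simp add: L2_loc_def)
    have "K \<in> sets lebesgue" using K by (simp add: borel_compact)
    then show "set_borel_measurable lebesgue K (\<lambda>x. (norm (g x $ i))\<^sup>2)"
      using meas by (simp add: set_borel_measurable_def)
    show "AE x in lebesgue. x \<in> K \<longrightarrow> norm ((norm (g x $ i))\<^sup>2) \<le> norm ((norm (g x))\<^sup>2)"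
      by (auto intro!: AE_I2 power_mono Finite_Cartesian_Product.norm_nth_le)
  qed
qed

text \<open>Local integrability comes from \<open>\<bar>t\<bar> \<le> 1 + t\<^sup>2\<close>, since constants are integrable on compact sets.\<close>

lemma L2_loc_borel_representative:
  fixes f :: "real ^ 'n::finite \<Rightarrow> complex"
  assumes f: "L2_loc f"
  obtains v where "locally_integrable v" "AE x in lborel. f x = v x"
proof -
  have fm [measurable]: "f \<in> borel_measurable lebesgue" using f by (simp add: L2_loc_def)
  obtain a b where ab: "a \<in> borel_measurable lborel" "b \<in> borel_measurable lborel"
    "AE x in lborel. Re (f x) = a x" "AE x in lborel. Im (f x) = b x"
    using completion_ex_borel_measurable_real[of "\<lambda>x. Re (f x)" lborel]
      completion_ex_borel_measurable_real[of "\<lambda>x. Im (f x)" lborel] fm by auto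
  define v where "v x = Complex (a x) (b x)" for x
  have vm [measurable]: "v \<in> borel_measurable borel"
    unfolding v_def[abs_def] Complex_eq using ab by simp
  have eq: "AE x in lborel. f x = v x"
    using ab(3,4) by eventually_elim (simp add: v_def complex_eq_iff)
  have "set_integrable lborel K v" if K: "compact K" for K
  proof -
    have [measurable]: "K \<in> sets borel" using K by (simp add: borel_compact)
    have "set_integrable lebesgue K (\<lambda>x. 1 + (norm (f x))\<^sup>2)"
    proof (rule set_integral_add(1))
      show "set_integrable lebesgue K (\<lambda>x. 1 :: real)"
        using K lmeasurable_compact[OF K] by (simp add: set_integrable_def fmeasurable_def)
    qed (use f K in \<open>simp add: L2_loc_def\<close>)
    moreover have Kf: "(\<lambda>x. indicat_real K x *\<^sub>R f x) \<in> borel_measurable lebesgue"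
    proof (rule borel_measurable_scaleR[OF _ fm])
      show "(\<lambda>x. indicat_real K x) \<in> borel_measurable lebesgue" by (rule measurable_completion) measurable
    qed
    ultimately have "integrable lebesgue (\<lambda>x. indicator K x *\<^sub>R f x)"
      unfolding set_integrable_def
    proof (rule Bochner_Integration.integrable_bound)
      show "AE x in lebesgue. norm (indicat_real K x *\<^sub>R f x) \<le> norm (indicat_real K x *\<^sub>R (1 + (cmod (f x))\<^sup>2))"
      proof (rule AE_I2)
        fix x
        have "cmod (f x) \<le> 1 + (cmod (f x))\<^sup>2"
          using sum_squares_ge_zero[of "cmod (f x) - 1" 0] zero_le_power2[of "cmod (f x)"]
          by (simp add: power2_eq_square algebra_simps) (use norm_ge_zero[of "f x"] in linarith)
        then show "norm (indicat_real K x *\<^sub>R f x) \<le> norm (indicat_real K x *\<^sub>R (1 + (cmod (f x))\<^sup>2))"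
          by (auto intro!: mult_left_mono simp: abs_of_nonneg[OF add_nonneg_nonneg])
      qed
    qed
    moreover have "AE x in lebesgue. indicat_real K x *\<^sub>R f x = indicat_real K x *\<^sub>R v x"
      using AE_completion[OF eq] by eventually_elim simp
    ultimately have "integrable lebesgue (\<lambda>x. indicator K x *\<^sub>R v x)"
      by (subst (asm) integrable_cong_AE) (auto intro: measurable_completion Kf)
    then show ?thesis unfolding set_integrable_def
      by (subst (asm) integrable_completion) auto
  qed
  then have "locally_integrable v" using vm by (simp add: locally_integrable_def)
  then show ?thesis using that eq by blast
qed

lemma bump_integral_representative:
  assumes "f \<in> borel_measurable borel" "u \<in> borel_measurable lebesgue" "locally_integrable v"
    "AE x in lborel. u x = v x"
  shows "(LINT x|lebesgue. f x *\<^sub>R u x) = (LINT x|lborel. f x *\<^sub>R v x)"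
proof -
  have [measurable]: "v \<in> borel_measurable borel" "f \<in> borel_measurable borel"
    using assms by (auto simp: locally_integrable_def)
  have [measurable]: "f \<in> borel_measurable lebesgue" "v \<in> borel_measurable lebesgue"
    by (auto intro: measurable_completion)
  note assms(2)[measurable]
  have "(LINT x|lebesgue. f x *\<^sub>R u x) = (LINT x|lebesgue. f x *\<^sub>R v x)"
    using AE_completion[OF assms(4)] by (intro integral_cong_AE) (auto elim: eventually_mono)
  also have "\<dots> = (LINT x|lborel. f x *\<^sub>R v x)"
    by (rule integral_completion) simp
  finally show ?thesis .
qed

lemma grad_weak_gradient:
  assumes "u \<in> H1_loc" shows "L2_loc (grad u)" "weak_gradient u (grad u)"
  using assms someI_ex[of "\<lambda>g. L2_loc g \<and> weak_gradient u g"]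
  by (auto simp: H1_loc_def grad_def)

text \<open>This transfers statements about \<open>grad\<close>, an arbitrary choice of a Lebesgue measurable weak gradient, to
  Borel functions, for which translations and product measures are available.\<close>

lemma H1_loc_borel_representative:
  fixes u :: "real ^ 'n::finite \<Rightarrow> complex"
  assumes u: "u \<in> H1_loc"
  obtains v G where "has_weak_partials v G" "AE x in lborel. u x = v x"
    "\<And>i. AE x in lborel. grad u x $ i = G i x"
proof -
  have L2: "L2_loc u" using u by (simp add: H1_loc_def)
  obtain v where v: "locally_integrable v" "AE x in lborel. u x = v x"
    using L2_loc_borel_representative[OF L2] by blast
  have "\<exists>g. locally_integrable g \<and> (AE x in lborel. grad u x $ i = g x)" for i
    using L2_loc_borel_representative[OF L2_loc_component[OF grad_weak_gradient(1)[OF u], of i]] by blast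
  then obtain G where G: "\<And>i. locally_integrable (G i)" "\<And>i. AE x in lborel. grad u x $ i = G i x"
    by metis
  have "(LINT x|lborel. partial i f x *\<^sub>R v x) = - (LINT x|lborel. f x *\<^sub>R G i x)" if f: "f \<in> bumps" for f i
  proof -
    have "(LINT x|lborel. partial i f x *\<^sub>R v x) = (LINT x|lebesgue. partial i f x *\<^sub>R u x)"
      using v L2 by (intro bump_integral_representative[symmetric] bumps_measurable bumps_partial f)
        (auto simp: L2_loc_def)
    also have "\<dots> = - (LINT x|lebesgue. f x *\<^sub>R (grad u x $ i))"
      using grad_weak_gradient(2)[OF u] bumps_test_function[OF f]
      by (simp add: weak_gradient_def partial_def)
    also have "(LINT x|lebesgue. f x *\<^sub>R (grad u x $ i)) = (LINT x|lborel. f x *\<^sub>R G i x)"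
      using G L2_loc_component[OF grad_weak_gradient(1)[OF u], of i]
      by (intro bump_integral_representative bumps_measurable f) (auto simp: L2_loc_def)
    finally show ?thesis .
  qed
  then have "has_weak_partials v G" using v G by (auto simp: has_weak_partials_def)
  then show ?thesis using that v G by blast
qed

lemma grad_scale:
  assumes u: "u \<in> H1_loc" and w: "w \<in> H1_loc" and eq: "AE x in lebesgue. w x = c * u x"
  shows "AE x in lebesgue. grad w x $ i = c * grad u x $ i"
proof -
  obtain v G where v: "has_weak_partials v G" "AE x in lborel. u x = v x"
    "\<And>i. AE x in lborel. grad u x $ i = G i x"
    using H1_loc_borel_representative[OF u] by blast
  obtain v' G' where v': "has_weak_partials v' G'" "AE x in lborel. w x = v' x"
    "\<And>i. AE x in lborel. grad w x $ i = G' i x"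
    using H1_loc_borel_representative[OF w] by blast
  have "AE x in lborel. v' x = c * v x"
    using v(2) v'(2) eq[unfolded AE_completion_iff] by eventually_elim simp
  from has_weak_partials_unique[OF v'(1) v(1) this, of i]
  have "AE x in lborel. grad w x $ i = c * grad u x $ i"
    using v(3)[of i] v'(3)[of i] by eventually_elim simp
  then show ?thesis by (rule AE_completion)
qed

section \<open>Definiteness of the energy on quasi-periodic functions\<close>

lemma unit_cell_borel [measurable]: "unit_cell \<in> sets borel"
proof -
  have "unit_cell = (\<Inter>i\<in>UNIV. {x :: real ^ 'a. x $ i > 0} \<inter> {x. x $ i \<le> 1})"
    by (auto simp: unit_cell_def)
  also have "\<dots> \<in> sets borel"
    by (intro sets.finite_INT sets.Int borel_open borel_closed
        open_halfspace_component_gt_cart closed_halfspace_component_le_cart) auto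
  finally show ?thesis .
qed

lemma unit_cell_subset_cbox: "unit_cell \<subseteq> cbox 0 (1 :: real ^ 'n::finite)"
  by (auto simp: unit_cell_def mem_box_cart less_imp_le)

lemma set_integrable_grad_norm_sq:
  assumes "u \<in> H1_loc" "S \<subseteq> unit_cell" "S \<in> sets lebesgue"
  shows "set_integrable lebesgue S (\<lambda>x. (norm (grad u x))\<^sup>2)"
proof (rule set_integrable_subset)
  show "set_integrable lebesgue (cbox 0 1) (\<lambda>x. (norm (grad u x))\<^sup>2)"
    using grad_weak_gradient(1)[OF assms(1)] by (simp add: L2_loc_def)
qed (use assms unit_cell_subset_cbox in auto)

lemma AE_lborel_translate:
  assumes "AE x in lborel. P x" shows "AE x in lborel. P (x + p)"
proof -
  have "AE x in distr lborel borel ((+) p). P x"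
    unfolding lborel_distr_plus by (rule assms)
  then have "AE x in lborel. P (p + x)" by (rule AE_distrD[rotated]) simp
  then show ?thesis by (simp add: add.commute)
qed

lemma countable_integer_vectors: "countable {p :: real ^ 'n::finite. \<forall>i. p $ i \<in> \<int>}"
proof -
  have "{p :: real ^ 'n. \<forall>i. p $ i \<in> \<int>} \<subseteq> (\<lambda>f. \<chi> i. f i) ` (UNIV \<rightarrow>\<^sub>E \<int>)"
  proof
    fix p :: "real ^ 'n" assume "p \<in> {p. \<forall>i. p $ i \<in> \<int>}"
    then show "p \<in> (\<lambda>f. \<chi> i. f i) ` (UNIV \<rightarrow>\<^sub>E \<int>)"
      by (intro image_eqI[where x = "\<lambda>i. p $ i"]) (auto simp: PiE_def)
  qed
  moreover have "countable (UNIV \<rightarrow>\<^sub>E (\<int> :: real set) :: ('n \<Rightarrow> real) set)"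
    by (intro countable_PiE) (auto simp: Ints_def)
  ultimately show ?thesis by (meson countable_image countable_subset)
qed

text \<open>The cell is open below and closed above, so the ceiling and not the floor gives the
  translation.\<close>

lemma translate_into_unit_cell:
  obtains p :: "real ^ 'n::finite" where "\<forall>i. p $ i \<in> \<int>" "x + p \<in> unit_cell"
proof
  let ?p = "\<chi> i. 1 - of_int \<lceil>x $ i\<rceil>"
  show "\<forall>i. ?p $ i \<in> \<int>" by auto
  have "0 < x $ i + (1 - of_int \<lceil>x $ i\<rceil>)" "x $ i + (1 - of_int \<lceil>x $ i\<rceil>) \<le> 1" for i by linarith+
  then show "x + ?p \<in> unit_cell" by (simp add: unit_cell_def)
qed

lemma unit_cell_lmeasurable: "unit_cell \<in> lmeasurable"
  by (rule fmeasurableI2[OF _ unit_cell_subset_cbox]) auto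

lemma measure_unit_cell: "measure lebesgue (unit_cell :: (real ^ 'n::finite) set) = 1"
proof -
  have sub: "box 0 1 \<subseteq> (unit_cell :: (real ^ 'n) set)" by (auto simp: unit_cell_def mem_box_cart less_imp_le)
  have "measure lebesgue (unit_cell :: (real ^ 'n) set) \<le> measure lebesgue (cbox 0 (1 :: real ^ 'n))"
    by (rule measure_mono_fmeasurable[OF unit_cell_subset_cbox]) auto
  moreover have fm: "unit_cell \<in> fmeasurable (lebesgue :: (real ^ 'n) measure)"
    by (rule unit_cell_lmeasurable)
  moreover have "measure lebesgue (box 0 (1 :: real ^ 'n)) \<le> measure lebesgue (unit_cell :: (real ^ 'n) set)"
    by (rule measure_mono_fmeasurable[OF sub _ fm]) auto
  moreover have one: "1 \<bullet> b = 1" if "b \<in> Basis" for b :: "real ^ 'n"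
    using that by (auto simp: Basis_vec_def inner_axis)
  have "measure lebesgue (cbox 0 (1 :: real ^ 'n)) = 1" "measure lebesgue (box 0 (1 :: real ^ 'n)) = 1"
    by (simp_all add: measure_lborel_cbox_eq measure_lborel_box_eq one)
  ultimately show ?thesis by linarith
qed

text \<open>The energy of the unit cell is positive definite on \<open>H1_per \<alpha>\<close>. Restricting \<open>\<alpha>\<close> to the Brillouin zone
  matters: if all components of a nonzero \<open>\<alpha>\<close> were multiples of \<open>2 pi\<close>, nonzero constants would belong
  to the space and have no energy.\<close>

lemma H1_per_zero_if_grad_norm_zero:
  fixes u :: "real ^ 'n::finite \<Rightarrow> complex"
  assumes \<alpha>: "\<alpha> \<in> brillouin_zone" and u: "u \<in> H1_per \<alpha>" and zero: "grad_norm_sq unit_cell u = 0"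
  shows "AE x in lebesgue. u x = 0"
proof -
  have uH: "u \<in> H1_loc" using u by (simp add: H1_per_def)
  have per: "AE x in lborel. u (x + p) = u x * cis (\<alpha> \<bullet> p)" if "\<forall>i. p $ i \<in> \<int>" for p
    using u that by (simp add: H1_per_def AE_completion_iff)
  obtain v G where v: "has_weak_partials v G" "AE x in lborel. u x = v x"
    "\<And>i. AE x in lborel. grad u x $ i = G i x"
    using H1_loc_borel_representative[OF uH] by blast
  have v_per: "AE x in lborel. v (x + p) = cis (\<alpha> \<bullet> p) * v x" if "\<forall>i. p $ i \<in> \<int>" for p
    using per[OF that] v(2) AE_lborel_translate[OF v(2), of p] by eventually_elim simp
  have "AE x in lebesgue. indicator unit_cell x *\<^sub>R (norm (grad u x))\<^sup>2 = 0"
    using set_integrable_grad_norm_sq[OF uH order_refl] zero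
    unfolding set_integrable_def grad_norm_sq_def set_lebesgue_integral_def
    by (subst integral_nonneg_eq_0_iff_AE[symmetric]) auto
  then have cell: "AE x in lborel. x \<in> unit_cell \<longrightarrow> grad u x = 0"
    unfolding AE_completion_iff by eventually_elim (auto simp: indicator_def split: if_splits)
  have G_cell: "AE x in lborel. x \<in> unit_cell \<longrightarrow> G i x = 0" for i
    using cell v(3)[of i] by eventually_elim auto
  \<comment> \<open>The gradient is quasi-periodic with the same phase, so its vanishing in the cell spreads to
    each of the countably many translated cells.\<close>
  have "AE x in lborel. x + p \<in> unit_cell \<longrightarrow> G i x = 0" if p: "p \<in> {p. \<forall>i. p $ i \<in> \<int>}" for i p
  proof -
    have "AE x in lborel. G i (x + p) = cis (\<alpha> \<bullet> p) * G i x"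
      using has_weak_partials_unique[OF has_weak_partials_translate[OF v(1)] v(1) v_per] p by blast
    then show ?thesis
      using AE_lborel_translate[OF G_cell, of p i] by eventually_elim auto
  qed
  then have "AE x in lborel. \<forall>p\<in>{p. \<forall>i. p $ i \<in> \<int>}. x + p \<in> unit_cell \<longrightarrow> G i x = 0" for i
    by (subst AE_ball_countable[OF countable_integer_vectors]) blast
  then have G0: "AE x in lborel. G i x = 0" for i
    by (rule eventually_mono) (use translate_into_unit_cell in blast)
  have "(LINT x|lborel. partial i f x *\<^sub>R v x) = 0" if f: "f \<in> bumps" for f i
  proof -
    have "(LINT x|lborel. f x *\<^sub>R G i x) = 0"
      by (rule integral_eq_zero_AE) (use G0[of i] in \<open>auto elim: eventually_mono\<close>)
    then show ?thesis using v(1) f by (simp add: has_weak_partials_def)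
  qed
  moreover have "locally_integrable v" using v(1) by (simp add: has_weak_partials_def)
  ultimately obtain c where "AE x in lborel. v x = c"
    using AE_constant_if_weak_gradient_zero[of v] by blast
  then have uc: "AE x in lborel. u x = c" using v(2) by eventually_elim simp
  have "c = 0"
  proof (cases "\<alpha> = 0")
    case True
    have "(LINT x:unit_cell|lebesgue. u x) = (LINT x:(unit_cell :: (real ^ 'n) set)|lebesgue. c)"
      using AE_completion[OF uc] uH
      by (intro set_lebesgue_integral_cong_AE) (auto simp: H1_loc_def L2_loc_def elim: eventually_mono)
    also have "\<dots> = c"
    proof -
      have "integrable lebesgue (indicat_real (unit_cell :: (real ^ 'n) set))"
        using unit_cell_lmeasurable by (simp add: integrable_indicator_iff fmeasurable_def)
      then have "(LINT x:(unit_cell :: (real ^ 'n) set)|lebesgue. c) =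
          (LINT x|lebesgue. indicat_real (unit_cell :: (real ^ 'n) set) x) *\<^sub>R c"
        unfolding set_lebesgue_integral_def by (intro integral_scaleR_left)
      then show ?thesis using measure_unit_cell[where 'n = 'n] by simp
    qed
    finally show ?thesis using u True by (simp add: H1_per_def)
  next
    case False
    then obtain i where i: "\<alpha> $ i \<noteq> 0" by (auto simp: vec_eq_iff)
    \<comment> \<open>A shift by one period in a direction with nonzero phase multiplies the constant by a number
      other than one.\<close>
    have "AE x in lborel. u (x + axis i 1) = u x * cis (\<alpha> $ i)"
      using per[of "axis i 1"] by (simp add: inner_axis) (simp add: axis_def)
    then have "AE x in lborel. u (x + axis i 1) = u x * cis (\<alpha> $ i) \<and> u x = c \<and> u (x + axis i 1) = c"
      using uc AE_lborel_translate[OF uc, of "axis i 1"] by eventually_elim simp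
    then obtain x where "u (x + axis i 1) = u x * cis (\<alpha> $ i) \<and> u x = c \<and> u (x + axis i 1) = c"
      by (rule AE_lborel_witness)
    then have "c = c * cis (\<alpha> $ i)" by metis
    moreover have "cis (\<alpha> $ i) \<noteq> 1"
    proof
      assume "cis (\<alpha> $ i) = 1"
      then have "cos (\<alpha> $ i) = 1" by (simp add: complex_eq_iff)
      moreover have "- pi < \<alpha> $ i" "\<alpha> $ i \<le> pi" using \<alpha> by (auto simp: brillouin_zone_def)
      ultimately show False using i
        cos_monotone_0_pi[of 0 "\<bar>\<alpha> $ i\<bar>"] by (simp add: abs_le_iff)
    qed
    ultimately show ?thesis by simp
  qed
  then show ?thesis using AE_completion[OF uc] by simp
qed

section \<open>The lowest eigenvalue\<close>

lemma dirichlet_form_self: "dirichlet_form S u u = of_real (grad_norm_sq S u)"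
proof -
  have "(\<Sum>i\<in>UNIV. grad u x $ i * cnj (grad u x $ i)) = complex_of_real ((norm (grad u x))\<^sup>2)" for x
    by (simp add: norm_vec_def L2_set_def sum_nonneg complex_norm_square[symmetric])
  then show ?thesis
    by (simp only: dirichlet_form_def grad_norm_sq_def set_integral_complex_of_real)
qed

lemma dirichlet_form_scale:
  assumes u: "u \<in> H1_loc" and w: "w \<in> H1_loc" and eq: "AE x in lebesgue. w x = c * u x"
    and S: "S \<in> sets lebesgue"
  shows "dirichlet_form S w u = c * of_real (grad_norm_sq S u)"
proof -
  have [measurable]: "(\<lambda>x. grad u x $ i) \<in> borel_measurable lebesgue" "(\<lambda>x. grad w x $ i) \<in> borel_measurable lebesgue" for i
    using L2_loc_component[OF grad_weak_gradient(1)] u w by (auto simp: L2_loc_def)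
  have [measurable]: "(\<lambda>x. cnj (grad u x $ i)) \<in> borel_measurable lebesgue" for i
    by (rule borel_measurable_continuous_on[where f = cnj]) (auto intro: continuous_intros)
  have "AE x in lebesgue. \<forall>i. grad w x $ i = c * grad u x $ i"
    unfolding AE_all_countable by (intro allI grad_scale[OF u w eq])
  then have "dirichlet_form S w u = (LINT x:S|lebesgue. c * (\<Sum>i\<in>UNIV. grad u x $ i * cnj (grad u x $ i)))"
    unfolding dirichlet_form_def using S
    by (intro set_lebesgue_integral_cong_AE) (auto elim!: eventually_mono simp: sum_distrib_left mult.assoc)
  also have "\<dots> = c * dirichlet_form S u u" by (simp add: dirichlet_form_def)
  finally show ?thesis by (simp add: dirichlet_form_self)
qed

theorem theorem8p1:
  fixes D :: "(real ^ 'n::finite) set"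
    and T :: "real ^ 'n \<Rightarrow> (real ^ 'n \<Rightarrow> complex) \<Rightarrow> (real ^ 'n \<Rightarrow> complex)"
    and \<theta> \<rho> :: real
  assumes dim: "CARD('n) \<in> {2, 3}"
    and D: "inclusions D"
    and T: "\<forall>\<alpha>\<in>brillouin_zone. is_T D \<alpha> (T \<alpha>)"
    and theta: "\<theta> > 0"
    and energy: "\<forall>\<alpha>\<in>brillouin_zone. \<forall>u\<in>W3 D \<alpha>.
                   grad_norm_sq (unit_cell - D) u \<ge> \<theta> * grad_norm_sq D u"
    and rho: "\<rho> = min (1/2) (\<theta>/2)"
  shows "\<forall>\<alpha>\<in>brillouin_zone. \<forall>\<mu>. lowest_eigenvalue D \<alpha> (T \<alpha>) \<mu> \<longrightarrow>
           \<not> (\<theta> = 1 \<and> \<mu> = 0) \<longrightarrow> \<mu> + 1/2 > \<rho>"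
proof (intro ballI allI impI)
  fix \<alpha> :: "real ^ 'n" and \<mu> assume \<alpha>: "\<alpha> \<in> brillouin_zone"
    and low: "lowest_eigenvalue D \<alpha> (T \<alpha>) \<mu>" and not_critical: "\<not> (\<theta> = 1 \<and> \<mu> = 0)"
  obtain u where u: "u \<in> W3 D \<alpha>" "\<not> (AE x in lebesgue. u x = 0)"
      and Tu: "AE x in lebesgue. T \<alpha> u x = of_real \<mu> * u x"
    using low by (auto simp: lowest_eigenvalue_def T_eigenvalue_def)
  have isT: "T \<alpha> u \<in> W3 D \<alpha>" "H_inner (T \<alpha> u) u =
      1/2 * dirichlet_form (unit_cell - D) u u - 1/2 * dirichlet_form D u u"
    using T \<alpha> u(1) by (auto simp: is_T_def)
  have H: "u \<in> H1_per \<alpha>" "u \<in> H1_loc" "T \<alpha> u \<in> H1_loc"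
    using u isT(1) by (auto simp: W3_def H1_per_def)
  have "open D" using D by (auto simp: inclusions_def)
  then have D_meas: "D \<in> sets lebesgue" by auto
  have D_sub: "D \<subseteq> unit_cell"
    using D closure_subset[of D] interior_subset by (auto simp: inclusions_def)
  define A where "A = grad_norm_sq (unit_cell - D) u"
  define B where "B = grad_norm_sq D u"
  have split: "grad_norm_sq unit_cell u = A + B"
  proof -
    have "grad_norm_sq ((unit_cell - D) \<union> D) u = A + B"
      unfolding A_def B_def grad_norm_sq_def
      by (intro set_integral_Un set_integrable_grad_norm_sq H) (use D_meas D_sub in auto)
    moreover have "(unit_cell - D) \<union> D = unit_cell" using D_sub by auto
    ultimately show ?thesis by simp
  qed
  have nonneg: "A \<ge> 0" "B \<ge> 0"
    unfolding A_def B_def grad_norm_sq_def set_lebesgue_integral_def by (auto intro!: integral_nonneg_AE)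
  have "A + B \<noteq> 0"
    using H1_per_zero_if_grad_norm_zero[OF \<alpha> H(1)] u(2) split by auto
  with nonneg have pos: "A + B > 0" by linarith
  \<comment> \<open>Testing the equation for \<open>T u\<close> with \<open>u\<close> expresses \<open>\<mu>\<close> as a Rayleigh quotient.\<close>
  have "of_real (\<mu> * (A + B)) = complex_of_real (1/2 * A - 1/2 * B)"
    using isT(2) dirichlet_form_scale[OF H(2,3) Tu, of unit_cell] split
    by (simp add: dirichlet_form_self A_def B_def)
  then have "\<mu> * (A + B) = 1/2 * A - 1/2 * B" by (simp only: of_real_eq_iff)
  then have rayleigh: "(\<mu> + 1/2) * (A + B) = A" by (simp add: field_simps)
  have AB: "A \<ge> \<theta> * B" using energy \<alpha> u(1) by (simp add: A_def B_def)
  have "\<rho> * (A + B) < A"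
  proof (cases "B = 0")
    case True
    then show ?thesis using pos rho by (auto simp: min_def)
  next
    case False
    then have B: "B > 0" using nonneg by simp
    consider "\<theta> < 1" | "\<theta> > 1" | "\<theta> = 1" by linarith
    then show ?thesis
    proof cases
      case 1
      then have "\<rho> = \<theta> / 2" using rho by (simp add: min_def)
      have "A > 0" using AB mult_pos_pos[OF theta B] by linarith
      then have "\<theta> * A < A" using 1 by simp
      then have "(\<theta> * A + \<theta> * B) / 2 < A" using AB by simp
      moreover have "\<rho> * (A + B) = (\<theta> * A + \<theta> * B) / 2"
        using \<open>\<rho> = \<theta> / 2\<close> by (simp add: field_simps)
      ultimately show ?thesis by linarith
    next
      case 2
      then have "B < \<theta> * B" using B by simp
      then have "B < A" using AB by (rule less_le_trans)
      then have "1/2 * (A + B) < A" by simp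
      moreover have "\<rho> = 1/2" using 2 rho by (simp add: min_def)
      ultimately show ?thesis by (simp only:)
    next
      \<comment> \<open>The bound alone gives \<open>A \<ge> B\<close>; the Rayleigh quotient excludes equality.\<close>
      case 3
      then have "\<mu> \<noteq> 0" using not_critical by simp
      then have "A \<noteq> B" using rayleigh pos by (auto simp: algebra_simps)
      then have "B < A" using AB 3 by simp
      then have "1/2 * (A + B) < A" by simp
      moreover have "\<rho> = 1/2" using 3 rho by simp
      ultimately show ?thesis by (simp only:)
    qed
  qed
  then have "\<rho> * (A + B) < (\<mu> + 1/2) * (A + B)" using rayleigh by simp
  then show "\<mu> + 1/2 > \<rho>" using pos by (simp add: mult_less_cancel_right)
qed

end
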